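(* For every instance of the vehicle routing problem with subtours (defined in the context), there exists a schedule $(W,A,\mu)$ with the following properties: - its delay is minimum among all schedules for the instance; - $(W,A)$ is a caterpillar; - $\mu(w)=\mu(r)$ for all $w\in W_2$.
   Context: An instance consists of a finite nonempty item set $P$, a root $r\notin P$, a metric space $(M,c)$, a map $\mu:\{r\}\cup P\to M$, and non-negative parameters $\delta,\sigma,\Delta$, with the standing assumption $\delta\ge1$. A schedule $(W,A,\mu)$ is an arborescence $(W,A)$ rooted at $r$ with $P\subseteq W$, together with an extension of $\mu$ to $W$. Every vertex has out-degree at most $2$, and vertices of $P$ have out-degree at most $1$. $W_i$ denotes the set of vertices of out-degree $i$. $W_{x*}$ is the vertex set of the subarborescence rooted at $x$. $W_{ry}$ and $A_{ry}$ are the vertex and arc sets of the $r$-$y$-path. The delay of the schedule is $\max_{p\in P}\mathrm{delay}(r,p)$, where $$\mathrm{delay}(r,y)=\sum_{(u,v)\in A_{ry}}c(\mu(u),\mu(v))+\delta|P\cap W_{ry}|+\sum_{w\in W_{ry}\cap W_2}\min_{(w,x)\in A}|P\cap W_{x*}|.$$ An arborescence is proper if its root is $r$ and has out-degree $1$, all elements of $P$ have out-degree $0$ or $1$, and all other vertices have out-degree $2$. A proper arborescence is a caterpillar if $W_1=\{r\}$ and the subgraph induced by $\{r\}\cup W_2$ is a path. *)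

theory Defs
  imports
    "Graph_Theory.Digraph_Component"
    "Graph_Theory.Pair_Digraph"
    "HOL-Analysis.Abstract_Metric_Spaces"
    "HOL-Library.Infinite_Typeclass"
begin

text \<open>
  An item set \<open>P\<close>, a root \<open>r\<close>, a metric space \<open>(M, c)\<close>, locations \<open>\<mu>\<close> (only the values on
  \<open>{r} \<union> P\<close> matter) and parameters \<open>\<delta>, \<sigma>, \<Delta>\<close>. Items, root and all further vertices of a
  schedule live in the same type \<open>'v\<close>; it has to be infinite (class \<open>infinite\<close>) for schedules to have
  enough fresh vertices available.
\<close>

locale vrp_subtours_instance = Metric_space M c
  for M :: "'m set" and c :: "'m \<Rightarrow> 'm \<Rightarrow> real" +
  fixes P :: "'v set" and r :: 'v and \<mu> :: "'v \<Rightarrow> 'm" and \<delta> \<sigma> \<Delta> :: real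
  assumes finite_items: "finite P"
    and items_nonempty: "P \<noteq> {}"
    and root_no_item: "r \<notin> P"
    and locations: "\<And>v. v \<in> insert r P \<Longrightarrow> \<mu> v \<in> M"
    and delta_ge_1: "\<delta> \<ge> 1"
    and sigma_nonneg: "\<sigma> \<ge> 0"
    and Delta_nonneg: "\<Delta> \<ge> 0"

definition arborescence :: "'v pair_pre_digraph \<Rightarrow> 'v \<Rightarrow> bool" where
  "arborescence G r \<longleftrightarrow> pair_fin_digraph G \<and> r \<in> pverts G \<and>
     (\<forall>v \<in> pverts G. \<exists>!p. pre_digraph.awalk (with_proj G) r p v)"

definition verts_of_out_degree :: "'v pair_pre_digraph \<Rightarrow> nat \<Rightarrow> 'v set" where
  "verts_of_out_degree G i = {v \<in> pverts G. out_degree (with_proj G) v = i}"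

definition sub_verts :: "'v pair_pre_digraph \<Rightarrow> 'v \<Rightarrow> 'v set" where
  "sub_verts G x = {v. x \<rightarrow>\<^sup>*\<^bsub>with_proj G\<^esub> v}"

text \<open>In an arborescence rooted at \<open>r\<close> the walk selected here is the \<open>r\<close>-\<open>y\<close>-path.\<close>

definition path_arcs :: "'v pair_pre_digraph \<Rightarrow> 'v \<Rightarrow> 'v \<Rightarrow> ('v \<times> 'v) set" where
  "path_arcs G r y = set (THE p. pre_digraph.awalk (with_proj G) r p y)"

definition path_verts :: "'v pair_pre_digraph \<Rightarrow> 'v \<Rightarrow> 'v \<Rightarrow> 'v set" where
  "path_verts G r y =
     set (pre_digraph.awalk_verts (with_proj G) r (THE p. pre_digraph.awalk (with_proj G) r p y))"

text \<open>\<open>\<mu>\<close> is the given map on \<open>{r} \<union> P\<close>, and \<open>\<mu>'\<close> its extension to all vertices.\<close>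

definition schedule ::
  "'m set \<Rightarrow> 'v set \<Rightarrow> 'v \<Rightarrow> ('v \<Rightarrow> 'm) \<Rightarrow> 'v pair_pre_digraph \<Rightarrow> ('v \<Rightarrow> 'm) \<Rightarrow> bool" where
  "schedule M P r \<mu> G \<mu>' \<longleftrightarrow>
     arborescence G r \<and> P \<subseteq> pverts G \<and>
     (\<forall>v \<in> insert r P. \<mu>' v = \<mu> v) \<and> (\<forall>v \<in> pverts G. \<mu>' v \<in> M) \<and>
     (\<forall>v \<in> pverts G. out_degree (with_proj G) v \<le> 2) \<and>
     (\<forall>p \<in> P. out_degree (with_proj G) p \<le> 1)"

definition delay_to ::
  "('m \<Rightarrow> 'm \<Rightarrow> real) \<Rightarrow> 'v set \<Rightarrow> 'v \<Rightarrow> real \<Rightarrow> 'v pair_pre_digraph \<Rightarrow> ('v \<Rightarrow> 'm) \<Rightarrow> 'v \<Rightarrow> real" where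
  "delay_to c P r \<delta> G \<mu> y =
     (\<Sum>(u, v) \<in> path_arcs G r y. c (\<mu> u) (\<mu> v)) +
     \<delta> * real (card (P \<inter> path_verts G r y)) +
     (\<Sum>w \<in> path_verts G r y \<inter> verts_of_out_degree G 2.
        real (Min {card (P \<inter> sub_verts G x) | x. (w, x) \<in> parcs G}))"

definition delay ::
  "('m \<Rightarrow> 'm \<Rightarrow> real) \<Rightarrow> 'v set \<Rightarrow> 'v \<Rightarrow> real \<Rightarrow> 'v pair_pre_digraph \<Rightarrow> ('v \<Rightarrow> 'm) \<Rightarrow> real" where
  "delay c P r \<delta> G \<mu> = Max (delay_to c P r \<delta> G \<mu> ` P)"

definition proper_arborescence :: "'v set \<Rightarrow> 'v \<Rightarrow> 'v pair_pre_digraph \<Rightarrow> bool" where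
  "proper_arborescence P r G \<longleftrightarrow>
     arborescence G r \<and> out_degree (with_proj G) r = 1 \<and>
     (\<forall>v \<in> pverts G \<inter> P. out_degree (with_proj G) v \<in> {0, 1}) \<and>
     (\<forall>v \<in> pverts G - insert r P. out_degree (with_proj G) v = 2)"

definition is_path_graph :: "('v, 'e) pre_digraph \<Rightarrow> bool" where
  "is_path_graph H \<longleftrightarrow>
     (\<exists>u p v. pre_digraph.apath H u p v \<and>
        verts H = set (pre_digraph.awalk_verts H u p) \<and> arcs H = set p)"

definition caterpillar :: "'v set \<Rightarrow> 'v \<Rightarrow> 'v pair_pre_digraph \<Rightarrow> bool" where
  "caterpillar P r G \<longleftrightarrow>
     proper_arborescence P r G \<and> verts_of_out_degree G 1 = {r} \<and>
     is_path_graph (with_proj G \<restriction> ({r} \<union> verts_of_out_degree G 2))"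

end

theory Submission
  imports Defs
begin

text \<open>
  Number the items by decreasing distance from the root and let \<open>c\<^sub>i\<close> be the distance of the
  \<open>i\<close>-th one. The caterpillar whose inner vertices all lie at \<open>\<mu> r\<close> and which hangs
  the items along its spine in this order serves item \<open>i\<close> with delay at most
  \<open>c\<^sub>i + \<delta> + min i (n - 1)\<close>, since each branching on the way has a single-item side.

  Conversely, in any schedule and for any set \<open>S\<close> of \<open>i\<close> items, some walk from the root to an item
  visits \<open>S\<close> and collects at least \<open>min (i + 1) n\<close> in item count plus branching costs: descend into
  the side with more items, unless it misses \<open>S\<close>. Taking for \<open>S\<close> the \<open>i\<close> farthest items, the
  triangle inequality bounds the length of this walk below by \<open>c\<^sub>i\<close>, and \<open>\<delta> \<ge> 1\<close> gives a
  delay of at least \<open>c\<^sub>i + \<delta> + min i (n - 1)\<close>.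
\<close>

section \<open>Unique walks and subtrees in arborescences\<close>

locale rooted_arborescence = pair_fin_digraph G for G :: "'v pair_pre_digraph" +
  fixes r :: 'v
  assumes root_in_verts: "r \<in> pverts G"
    and unique_root_walk: "v \<in> pverts G \<Longrightarrow> \<exists>!p. awalk r p v"

lemma arborescence_iff_rooted: "arborescence G r \<longleftrightarrow> rooted_arborescence G r"
  by (auto simp: arborescence_def rooted_arborescence_def rooted_arborescence_axioms_def)

definition items_below :: "'v pair_pre_digraph \<Rightarrow> 'v set \<Rightarrow> 'v \<Rightarrow> nat" where
  "items_below G P x = card (P \<inter> sub_verts G x)"

definition branch_cost :: "'v pair_pre_digraph \<Rightarrow> 'v set \<Rightarrow> 'v \<Rightarrow> nat" where
  "branch_cost G P w = Min {items_below G P x | x. (w, x) \<in> parcs G}"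

text \<open>This is the part of the delay collected on a vertex set when travel is ignored and
  \<open>\<delta>\<close> is replaced by 1. It is a natural number, so the combinatorial argument
  runs without the metric and without \<open>\<delta>\<close>.\<close>

definition load :: "'v pair_pre_digraph \<Rightarrow> 'v set \<Rightarrow> 'v set \<Rightarrow> nat" where
  "load G P V = card (P \<inter> V) + (\<Sum>w\<in>V \<inter> verts_of_out_degree G 2. branch_cost G P w)"

lemma load_insert:
  assumes "finite V" "x \<notin> V"
  shows "load G P (insert x V) = of_bool (x \<in> P) +
    (if x \<in> verts_of_out_degree G 2 then branch_cost G P x else 0) + load G P V"
  using assms by (auto simp: load_def Int_insert_left Int_insert_right)

lemma out_degree_with_proj: "out_degree (with_proj G) v = card {x. (v, x) \<in> parcs G}"
proof -
  have "out_arcs (with_proj G) v = Pair v ` {x. (v, x) \<in> parcs G}"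
    by (auto simp: out_arcs_def)
  then show ?thesis
    by (simp add: out_degree_def card_image inj_on_def)
qed

context rooted_arborescence
begin

text \<open>Prefixing both walks with a root walk to \<open>x\<close> yields two root walks to
  \<open>v\<close>; these coincide, and the common prefix cancels. Acyclicity and disjointness of
  sibling subtrees follow from this.\<close>

lemma unique_walk:
  assumes "awalk x p v" "awalk x q v"
  shows "p = q"
proof -
  obtain s where s: "awalk r s x"
    using unique_root_walk assms(1) by blast
  have "awalk r (s @ p) v" "awalk r (s @ q) v"
    using s assms by (blast intro: awalk_appendI)+
  then show ?thesis
    using unique_root_walk[of v] by (blast dest: same_append_eq[THEN iffD1])
qed

lemma path_arcs_eq: "awalk r p y \<Longrightarrow> path_arcs G r y = set p"
  unfolding path_arcs_def by (metis the_equality unique_walk)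

lemma path_verts_eq: "awalk r p y \<Longrightarrow> path_verts G r y = set (pawalk_verts r p)"
  unfolding path_verts_def awalk_verts_with_proj_eq by (metis the_equality unique_walk)

text \<open>Every walk contains a path with the same ends, and by uniqueness the walk is that path.
  Hence a sum over the arc set equals the sum along the arc list, which is easier for
  induction.\<close>

lemma distinct_walk:
  assumes "awalk x p v"
  shows "distinct p"
  by (metis apath_def apath_awalk_to_apath assms awalkI_apath distinct_verts_imp_distinct unique_walk)

lemma mem_sub_verts_iff: "v \<in> sub_verts G x \<longleftrightarrow> (\<exists>p. awalk x p v)"
  by (auto simp: sub_verts_def reachable_awalk)

lemma sub_verts_subset: "sub_verts G x \<subseteq> pverts G"
  by (auto simp: sub_verts_def dest: reachable_in_verts)

lemma finite_sub_verts [simp]: "finite (sub_verts G x)"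
  using sub_verts_subset pair_finite_verts finite_subset by blast

lemma sub_verts_eq:
  assumes "x \<in> pverts G"
  shows "sub_verts G x = insert x (\<Union>z\<in>{z. (x, z) \<in> parcs G}. sub_verts G z)"
proof (intro set_eqI iffI)
  fix v assume "v \<in> sub_verts G x"
  then obtain p where "awalk x p v" by (auto simp: mem_sub_verts_iff)
  then show "v \<in> insert x (\<Union>z\<in>{z. (x, z) \<in> parcs G}. sub_verts G z)"
    by (cases p) (auto simp: awalk_simps mem_sub_verts_iff)
next
  fix v assume "v \<in> insert x (\<Union>z\<in>{z. (x, z) \<in> parcs G}. sub_verts G z)"
  then consider "v = x" | z p where "(x, z) \<in> parcs G" "awalk z p v"
    by (auto simp: mem_sub_verts_iff)
  then show "v \<in> sub_verts G x"
  proof cases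
    case 1
    then show ?thesis using assms by (auto simp: mem_sub_verts_iff awalk_Nil_iff intro: exI[of _ "[]"])
  next
    case 2
    then have "awalk x ((x, z) # p) v" by (simp add: awalk_Cons_iff)
    then show ?thesis by (auto simp: mem_sub_verts_iff)
  qed
qed

text \<open>Otherwise a closed walk through \<open>z\<close> would compete with the empty walk at
  \<open>x\<close>.\<close>

lemma notin_sub_verts_child:
  assumes "(x, z) \<in> parcs G"
  shows "x \<notin> sub_verts G z"
proof
  assume "x \<in> sub_verts G z"
  then obtain p where "awalk z p x" by (auto simp: mem_sub_verts_iff)
  then have "awalk x ((x, z) # p) x" using assms by (simp add: awalk_Cons_iff)
  moreover have "awalk x [] x" using in_arcsD1[OF assms] by (simp add: awalk_Nil_iff)
  ultimately show False using unique_walk by blast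
qed

text \<open>A common descendant would be reached from \<open>x\<close> by two walks with different
  first arcs.\<close>

lemma sub_verts_disjoint:
  assumes "(x, y) \<in> parcs G" "(x, z) \<in> parcs G" "y \<noteq> z"
  shows "sub_verts G y \<inter> sub_verts G z = {}"
proof (rule ccontr)
  assume "\<not> ?thesis"
  then obtain v p q where "awalk y p v" "awalk z q v" by (auto simp: mem_sub_verts_iff)
  then have "awalk x ((x, y) # p) v" "awalk x ((x, z) # q) v"
    using assms by (simp_all add: awalk_Cons_iff)
  then show False using unique_walk assms(3) by blast
qed

lemma walk_verts_subset_sub_verts: "awalk x p v \<Longrightarrow> set (pawalk_verts x p) \<subseteq> sub_verts G x"
  by (auto simp: sub_verts_def dest: awalk_verts_reachable_from)

section \<open>Walks with large load\<close>

lemma load_Cons: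
  assumes "(x, z) \<in> parcs G" "awalk z p v"
  shows "load G P (set (pawalk_verts x ((x, z) # p))) = of_bool (x \<in> P) +
    (if x \<in> verts_of_out_degree G 2 then branch_cost G P x else 0) + load G P (set (pawalk_verts z p))"
proof -
  have "x \<notin> set (pawalk_verts z p)"
    using notin_sub_verts_child[OF assms(1)] walk_verts_subset_sub_verts[OF assms(2)] by blast
  then show ?thesis by (simp add: load_insert)
qed

text \<open>The walk only has to meet \<open>S\<close>, not to end in it: an item of \<open>S\<close> above other items
  forces the walk to continue below it.\<close>

lemma heavy_walk:
  assumes deg: "\<And>v. v \<in> pverts G \<Longrightarrow> card {z. (v, z) \<in> parcs G} \<le> 2"
    and degP: "\<And>v. v \<in> P \<Longrightarrow> card {z. (v, z) \<in> parcs G} \<le> 1"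
    and x: "x \<in> pverts G" and S: "S \<subseteq> P \<inter> sub_verts G x" "S \<noteq> {}"
  shows "\<exists>y p. y \<in> P \<and> awalk x p y \<and> set (pawalk_verts x p) \<inter> S \<noteq> {} \<and>
    min (Suc (card S)) (items_below G P x) \<le> load G P (set (pawalk_verts x p))"
  using x S
proof (induction "card (sub_verts G x)" arbitrary: x S rule: less_induct)
  case less
  let ?C = "{z. (x, z) \<in> parcs G}"
  note sub = sub_verts_eq[OF less.prems(1)]
  \<comment> \<open>Extends the walk that the induction hypothesis gives for a child
    \<open>z\<close> by the arc from \<open>x\<close>. The target \<open>T\<close> is left free,
    since it need not be the trace of \<open>S\<close> below \<open>z\<close>.\<close>
  have child: "\<exists>y p. y \<in> P \<and> awalk x p y \<and> set (pawalk_verts x p) \<inter> T \<noteq> {} \<and>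
      of_bool (x \<in> P) + (if x \<in> verts_of_out_degree G 2 then branch_cost G P x else 0) +
      min (Suc (card T)) (items_below G P z) \<le> load G P (set (pawalk_verts x p))"
    if z: "(x, z) \<in> parcs G" and T: "T \<subseteq> P \<inter> sub_verts G z" "T \<noteq> {}" for z T
  proof -
    have "sub_verts G z \<subset> sub_verts G x"
      using notin_sub_verts_child[OF z] sub z by auto
    then have "card (sub_verts G z) < card (sub_verts G x)"
      by (simp add: psubset_card_mono)
    from less.hyps[OF this in_arcsD2[OF z] T] obtain y p where
      yp: "y \<in> P" "awalk z p y" "set (pawalk_verts z p) \<inter> T \<noteq> {}"
        "min (Suc (card T)) (items_below G P z) \<le> load G P (set (pawalk_verts z p))"
      by blast
    then have "awalk x ((x, z) # p) y" using z by (simp add: awalk_Cons_iff)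
    moreover have "set (pawalk_verts x ((x, z) # p)) \<inter> T \<noteq> {}" using yp by auto
    ultimately show ?thesis
      using yp load_Cons[OF z yp(2), of P] by (intro exI[of _ y] exI[of _ "(x, z) # p"]) auto
  qed
  have finS: "finite S" using less.prems(2) finite_sub_verts finite_subset by blast
  have finC: "finite ?C"
    by (rule finite_subset[of _ "pverts G"]) (use pair_finite_verts in_arcsD2 in auto)
  consider "?C = {}" | z where "?C = {z}" | y z where "?C = {y, z}" "y \<noteq> z"
  proof -
    have "card ?C = 0 \<or> card ?C = 1 \<or> card ?C = 2"
      using deg[OF less.prems(1)] by linarith
    then show thesis
      using that finC by (auto simp: card_1_singleton_iff card_2_iff)
  qed
  then show ?case
  proof cases
    case 1
    then have "sub_verts G x = {x}" using sub by auto
    then have "S = {x}" "x \<in> P" "items_below G P x = 1"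
      using less.prems by (auto simp: items_below_def)
    then show ?thesis
      using less.prems(1)
      by (intro exI[of _ x] exI[of _ "[]"]) (auto simp: awalk_Nil_iff load_insert)
  next
    case (2 z)
    then have z: "(x, z) \<in> parcs G" and sub': "sub_verts G x = insert x (sub_verts G z)"
      using sub by auto
    have nz: "items_below G P x = of_bool (x \<in> P) + items_below G P z"
      using notin_sub_verts_child[OF z] by (auto simp: items_below_def sub' Int_insert_right)
    show ?thesis
    proof (cases "x \<in> S")
      case False
      then have "S \<subseteq> P \<inter> sub_verts G z" using less.prems(2) sub' by auto
      from child[OF z this less.prems(3)] show ?thesis
        unfolding nz by (elim ex_forward conj_forward) auto
    next
      case True
      then have xP: "x \<in> P" using less.prems(2) by auto
      show ?thesis
      proof (cases "P \<inter> sub_verts G z = {}")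
        case True
        then have "items_below G P x = 1" using nz xP by (simp add: items_below_def)
        then show ?thesis
          using less.prems(1) xP \<open>x \<in> S\<close>
          by (intro exI[of _ x] exI[of _ "[]"]) (auto simp: awalk_Nil_iff load_insert)
      next
        case False
        \<comment> \<open>Since \<open>x\<close> itself already meets \<open>S\<close>, the target
          below \<open>z\<close> can be enlarged to all items there. The walk then has load at least
          \<open>items_below G P z\<close>, and \<open>x\<close> adds 1.\<close>
        from child[OF z order.refl this] obtain y p where
          yp: "y \<in> P" "awalk x p y" and
          le: "1 + min (Suc (items_below G P z)) (items_below G P z) \<le> load G P (set (pawalk_verts x p))"
          using xP unfolding items_below_def by fastforce
        have "x \<in> set (pawalk_verts x p)" using hd_in_awalk_verts(1)[OF yp(2)] by simp
        then show ?thesis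
          using yp le xP \<open>x \<in> S\<close> nz by (intro exI[of _ y] exI[of _ p]) auto
      qed
    qed
  next
    case (3 y z)
    then have y: "(x, y) \<in> parcs G" and z: "(x, z) \<in> parcs G" by auto
    have sub': "sub_verts G x = insert x (sub_verts G y \<union> sub_verts G z)"
      using sub 3 by auto
    have disj: "sub_verts G y \<inter> sub_verts G z = {}"
      by (rule sub_verts_disjoint[OF y z 3(2)])
    have card2: "card ?C = 2" using 3 by simp
    then have xP: "x \<notin> P" using degP by fastforce
    have x2: "x \<in> verts_of_out_degree G 2"
      using less.prems(1) card2 by (simp add: verts_of_out_degree_def out_degree_with_proj)
    have "{items_below G P v | v. (x, v) \<in> parcs G} = items_below G P ` ?C" by auto
    then have bc: "branch_cost G P x = min (items_below G P y) (items_below G P z)"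
      unfolding branch_cost_def 3 by simp
    have nx: "items_below G P x = items_below G P y + items_below G P z"
    proof -
      have "P \<inter> sub_verts G x = (P \<inter> sub_verts G y) \<union> (P \<inter> sub_verts G z)"
        using sub' xP by auto
      then show ?thesis
        using disj unfolding items_below_def by (auto intro!: card_Un_disjoint)
    qed
    let ?Sy = "S \<inter> sub_verts G y" and ?Sz = "S \<inter> sub_verts G z"
    have S: "S = ?Sy \<union> ?Sz" using less.prems(2) sub' xP by auto
    then have cS: "card S = card ?Sy + card ?Sz"
      using disj finS by (metis (no_types, lifting) Int_assoc Int_empty_right Int_left_commute card_Un_disjoint finite_Int)
    have le_y: "card ?Sy \<le> items_below G P y" and le_z: "card ?Sz \<le> items_below G P z"
      unfolding items_below_def using less.prems(2) by (auto intro!: card_mono)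
    have via: ?thesis
      if v: "(x, v) \<in> parcs G" and ne: "S \<inter> sub_verts G v \<noteq> {}"
        and bound: "min (Suc (card S)) (items_below G P x) \<le>
          branch_cost G P x + min (Suc (card (S \<inter> sub_verts G v))) (items_below G P v)" for v
    proof -
      have "S \<inter> sub_verts G v \<subseteq> P \<inter> sub_verts G v" using less.prems(2) by auto
      from child[OF v this ne] show ?thesis
        using x2 bound by (elim ex_forward conj_forward) (auto simp: xP)
    qed
    have ne_iff: "S \<inter> sub_verts G v \<noteq> {} \<longleftrightarrow> card (S \<inter> sub_verts G v) > 0" for v
      using finS by (auto simp: card_gt_0_iff)
    have "card S > 0" using less.prems(3) finS by (simp add: card_gt_0_iff)
    \<comment> \<open>The chosen side meets \<open>S\<close> and either carries all of
      \<open>S\<close> or has at least as many items as the other side. On the larger side, the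
      branching cost equals the item count of the other side and so makes up for the targets left
      there. If all of \<open>S\<close> is on the chosen side, the extra 1 is missing only when
      \<open>S\<close> exhausts the items of that side; then the branching cost is positive unless
      the other side is empty, and in that case no further unit is required.\<close>
    then consider "card ?Sy > 0" "card ?Sz = 0 \<or> items_below G P y \<ge> items_below G P z"
      | "card ?Sz > 0" "card ?Sy = 0 \<or> items_below G P z \<ge> items_below G P y"
      using cS by linarith
    then show ?thesis
    proof cases
      case 1
      then show ?thesis
        using le_y le_z cS nx bc by (intro via[OF y]) (auto simp: ne_iff)
    next
      case 2
      then show ?thesis
        using le_y le_z cS nx bc by (intro via[OF z]) (auto simp: ne_iff)
    qed
  qed
qed


lemma sub_verts_root: "sub_verts G r = pverts G"
  using sub_verts_subset unique_root_walk by (force simp: mem_sub_verts_iff)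

lemma delay_to_eq:
  assumes "awalk r p y"
  shows "delay_to c P r \<delta> G \<nu> y = (\<Sum>(u, v)\<leftarrow>p. c (\<nu> u) (\<nu> v)) +
    \<delta> * real (card (P \<inter> set (pawalk_verts r p))) +
    real (\<Sum>w\<in>set (pawalk_verts r p) \<inter> verts_of_out_degree G 2. branch_cost G P w)"
  using distinct_walk[OF assms]
  by (simp add: delay_to_def path_arcs_eq[OF assms] path_verts_eq[OF assms]
      sum_list_distinct_conv_sum_set branch_cost_def items_below_def)

end

section \<open>Lower bound on the delay of an arbitrary schedule\<close>

text \<open>The triangle inequality handles the arcs up to \<open>q\<close>, and the arcs after
  \<open>q\<close> have non-negative length. The walk may thus pass \<open>q\<close> and end
  elsewhere, as heavy walks do.\<close>

lemma (in Metric_space) walk_length_ge: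
  assumes "pcas x p y" "q \<in> set (pawalk_verts x p)" "\<And>v. v \<in> set (pawalk_verts x p) \<Longrightarrow> \<nu> v \<in> M"
  shows "d (\<nu> x) (\<nu> q) \<le> (\<Sum>(u, v)\<leftarrow>p. d (\<nu> u) (\<nu> v))"
  using assms
proof (induction p arbitrary: x)
  case Nil
  then show ?case by simp
next
  case (Cons e p)
  obtain z where e: "e = (x, z)" using Cons.prems(1) by (cases e) auto
  have nonneg_rest: "0 \<le> (\<Sum>(u, v)\<leftarrow>p. d (\<nu> u) (\<nu> v))"
    by (intro sum_list_nonneg) auto
  show ?case
  proof (cases "q = x")
    case True
    then show ?thesis using Cons.prems(3) nonneg_rest e by (simp add: add_nonneg_nonneg)
  next
    case False
    have cas: "pcas z p y" and q: "q \<in> set (pawalk_verts z p)"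
      and M: "\<And>v. v \<in> set (pawalk_verts z p) \<Longrightarrow> \<nu> v \<in> M"
      using Cons.prems e False by auto
    have "z \<in> set (pawalk_verts z p)" by (cases p) (use cas in auto)
    then have "d (\<nu> x) (\<nu> q) \<le> d (\<nu> x) (\<nu> z) + d (\<nu> z) (\<nu> q)"
      using M q Cons.prems(3) e by (intro triangle) auto
    with Cons.IH[OF cas q M] show ?thesis by (simp add: e)
  qed
qed

text \<open>A heavy walk for \<open>S\<close> gives both bounds at once: it visits some item of
  \<open>S\<close>, so its length is at least \<open>a\<close>, and its load is large.\<close>

lemma (in Metric_space) schedule_delay_ge:
  assumes sched: "schedule M P r \<mu> G \<nu>" and "finite P" "\<delta> \<ge> 1"
    and S: "S \<subseteq> P" "S \<noteq> {}" and far: "\<And>s. s \<in> S \<Longrightarrow> a \<le> d (\<mu> r) (\<mu> s)"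
  shows "a + \<delta> + real (min (card S) (card P - 1)) \<le> delay d P r \<delta> G \<nu>"
proof -
  interpret rooted_arborescence G r
    using sched by (simp add: schedule_def arborescence_iff_rooted)
  have PG: "P \<subseteq> pverts G" and \<nu>: "\<And>v. v \<in> insert r P \<Longrightarrow> \<nu> v = \<mu> v" "\<And>v. v \<in> pverts G \<Longrightarrow> \<nu> v \<in> M"
    and deg: "\<And>v. v \<in> pverts G \<Longrightarrow> card {z. (v, z) \<in> parcs G} \<le> 2"
    and degP: "\<And>v. v \<in> P \<Longrightarrow> card {z. (v, z) \<in> parcs G} \<le> 1"
    using sched by (auto simp: schedule_def out_degree_with_proj)
  have "S \<subseteq> P \<inter> sub_verts G r" using S PG by (auto simp: sub_verts_root)
  from heavy_walk[OF deg degP root_in_verts this S(2)] obtain y p s where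
    y: "y \<in> P" "awalk r p y" and s: "s \<in> S" "s \<in> set (pawalk_verts r p)"
    and le: "min (Suc (card S)) (items_below G P r) \<le> load G P (set (pawalk_verts r p))"
    by auto
  define k where "k = card (P \<inter> set (pawalk_verts r p))"
  define B where "B = (\<Sum>w\<in>set (pawalk_verts r p) \<inter> verts_of_out_degree G 2. branch_cost G P w)"
  have below: "items_below G P r = card P"
    using PG by (simp add: items_below_def sub_verts_root Int_absorb2)
  have verts: "set (pawalk_verts r p) \<subseteq> pverts G" and cas: "pcas r p y"
    using y(2) by (auto elim!: awalkE)
  have "a \<le> d (\<nu> r) (\<nu> s)" using far[OF s(1)] \<nu>(1) s(1) S by auto
  also have "\<dots> \<le> (\<Sum>(u, v)\<leftarrow>p. d (\<nu> u) (\<nu> v))"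
    using walk_length_ge[OF cas s(2)] \<nu>(2) verts by auto
  finally have travel: "a \<le> (\<Sum>(u, v)\<leftarrow>p. d (\<nu> u) (\<nu> v))" .
  have "k > 0" unfolding k_def using s S by (auto simp: card_gt_0_iff)
  \<comment> \<open>One of the \<open>k\<close> items is charged the full \<open>\<delta>\<close>
    and the others at least 1 each. This is why \<open>\<delta>\<close> appears once in the bound
    and the load is reduced by 1.\<close>
  then have "1 * (real k - 1) \<le> \<delta> * (real k - 1)" using \<open>\<delta> \<ge> 1\<close> by (intro mult_right_mono) auto
  then have "\<delta> + real k - 1 \<le> \<delta> * real k" by (simp add: algebra_simps)
  moreover have "min (Suc (card S)) (card P) \<le> k + B"
    using le by (simp add: load_def k_def B_def below)
  then have "real (min (card S) (card P - 1)) \<le> real k + real B - 1" using \<open>k > 0\<close> by linarith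
  ultimately have "a + \<delta> + real (min (card S) (card P - 1)) \<le> delay_to d P r \<delta> G \<nu> y"
    using travel unfolding delay_to_eq[OF y(2)] k_def[symmetric] B_def[symmetric] by linarith
  also have "\<dots> \<le> delay d P r \<delta> G \<nu>"
    unfolding delay_def using y(1) \<open>finite P\<close> by (intro Max_ge) auto
  finally show ?thesis .
qed

section \<open>The caterpillar and its delay\<close>

text \<open>With at most one arc into each vertex and none into the root, a walk can be traced back
  from its end without choice; hence the induction removes last arcs.\<close>

lemma (in pair_wf_digraph) unique_root_walkI:
  assumes in_unique: "\<And>u u' v. (u, v) \<in> parcs G \<Longrightarrow> (u', v) \<in> parcs G \<Longrightarrow> u = u'"
    and root: "\<And>u. (u, r) \<notin> parcs G"
    and "awalk r p v" "awalk r p' v"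
  shows "p = p'"
  using assms(3,4)
proof (induction p arbitrary: v p' rule: rev_induct)
  case Nil
  then show ?case
    by (cases p' rule: rev_cases) (auto simp: awalk_simps root)
next
  case (snoc e p)
  obtain u where e: "e = (u, v)" "(u, v) \<in> parcs G" and p: "awalk r p u"
    using snoc.prems(1) by (cases e) (auto simp: awalk_simps)
  show ?case
  proof (cases p' rule: rev_cases)
    case Nil
    then show ?thesis using snoc.prems(2) e root by (auto simp: awalk_simps)
  next
    case (snoc s e')
    then obtain u' where e': "e' = (u', v)" "(u', v) \<in> parcs G" and s: "awalk r s u'"
      using \<open>awalk r p' v\<close> by (cases e') (auto simp: awalk_simps)
    have "u' = u" using in_unique e e' by blast
    with snoc.IH[OF p] s e e' snoc show ?thesis by simp
  qed
qed

text \<open>The spine starts at the root \<open>w 0\<close> and continues with the branching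
  vertices \<open>w 1\<close> to \<open>w (n - 1)\<close>; the items \<open>q j\<close> are the
  leaves, in the order in which they hang. For \<open>n = 1\<close> only the arc from
  \<open>w 0\<close> to \<open>q 0\<close> remains.\<close>

locale caterpillar_layout =
  fixes n :: nat and w q :: "nat \<Rightarrow> 'v"
  assumes n_pos: "n > 0"
    and inj_w: "inj_on w {..<n}" and inj_q: "inj_on q {..<n}"
    and disjoint: "w ` {..<n} \<inter> q ` {..<n} = {}"
begin

definition next_vert :: "nat \<Rightarrow> 'v" where
  "next_vert j = (if Suc j < n then w (Suc j) else q j)"

text \<open>Item \<open>q j\<close> hangs at \<open>w (Suc j)\<close> rather than at
  \<open>w j\<close>, so that the root keeps out-degree 1. The last item takes the place of the next
  spine vertex, so for \<open>n > 1\<close> the vertex \<open>w (n - 1)\<close> carries two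
  items.\<close>

definition graph :: "'v pair_pre_digraph" where
  "graph = \<lparr>pverts = w ` {..<n} \<union> q ` {..<n},
    parcs = {(w j, next_vert j) | j. j < n} \<union> {(w (Suc j), q j) | j. Suc j < n}\<rparr>"

lemma w_eq_iff: "i < n \<Longrightarrow> j < n \<Longrightarrow> w i = w j \<longleftrightarrow> i = j"
  using inj_w by (auto simp: inj_on_def)

lemma q_eq_iff: "i < n \<Longrightarrow> j < n \<Longrightarrow> q i = q j \<longleftrightarrow> i = j"
  using inj_q by (auto simp: inj_on_def)

lemma w_neq_q: "i < n \<Longrightarrow> j < n \<Longrightarrow> w i \<noteq> q j"
  using disjoint by auto

lemmas layout_simps = w_eq_iff q_eq_iff w_neq_q w_neq_q[symmetric]

lemma pverts_graph: "pverts graph = w ` {..<n} \<union> q ` {..<n}"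
  by (simp add: graph_def)

text \<open>Separates spine arcs from item arcs. The minimum accounts for the last item, which has
  no spine vertex of its own; the same index later counts the branchings on the way to
  \<open>q j\<close>.\<close>

lemma parcs_graph: "(u, v) \<in> parcs graph \<longleftrightarrow>
    (\<exists>j. Suc j < n \<and> u = w j \<and> v = w (Suc j)) \<or>
    (\<exists>j<n. u = w (min (Suc j) (n - 1)) \<and> v = q j)"
  (is "?L \<longleftrightarrow> ?A \<or> ?B")
proof
  assume ?L
  then consider j where "j < n" "u = w j" "v = next_vert j" | j where "Suc j < n" "u = w (Suc j)" "v = q j"
    by (auto simp: graph_def)
  then show "?A \<or> ?B"
  proof cases
    case (1 j)
    show ?thesis
    proof (cases "Suc j < n")
      case True
      then show ?thesis using 1 by (auto simp: next_vert_def)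
    next
      case False
      then have "min (Suc j) (n - 1) = j" using 1 by simp
      then show ?thesis using 1 False by (intro disjI2 exI[of _ j]) (simp add: next_vert_def)
    qed
  next
    case (2 j)
    then have "min (Suc j) (n - 1) = Suc j" by simp
    then show ?thesis using 2 by (intro disjI2 exI[of _ j]) simp
  qed
next
  assume "?A \<or> ?B"
  then show ?L
  proof
    assume ?B
    then obtain j where j: "j < n" "u = w (min (Suc j) (n - 1))" "v = q j" by auto
    show ?L
    proof (cases "Suc j < n")
      case True
      then have "min (Suc j) (n - 1) = Suc j" by simp
      then show ?thesis using j True by (auto simp: graph_def)
    next
      case False
      then have "min (Suc j) (n - 1) = j" using j by simp
      then show ?thesis using j False by (auto simp: graph_def next_vert_def)
    qed
  qed (auto simp: graph_def next_vert_def)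
qed

lemma finite_parcs_graph: "finite (parcs graph)"
proof -
  have "parcs graph \<subseteq> pverts graph \<times> pverts graph"
    using n_pos by (auto simp: parcs_graph pverts_graph)
  then show ?thesis by (rule finite_subset) (simp add: pverts_graph)
qed

sublocale pair_fin_digraph graph
  by unfold_locales (use n_pos finite_parcs_graph in \<open>auto simp: parcs_graph pverts_graph\<close>)

definition spine_walk :: "nat \<Rightarrow> ('v \<times> 'v) list" where
  "spine_walk k = map (\<lambda>i. (w i, w (Suc i))) [0..<k]"

definition item_walk :: "nat \<Rightarrow> ('v \<times> 'v) list" where
  "item_walk i = spine_walk (min (Suc i) (n - 1)) @ [(w (min (Suc i) (n - 1)), q i)]"

lemma awalk_spine_walk: "k < n \<Longrightarrow> awalk (w 0) (spine_walk k) (w k)"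
proof (induction k)
  case 0
  then show ?case by (simp add: spine_walk_def awalk_Nil_iff pverts_graph)
next
  case (Suc k)
  then have "awalk (w k) [(w k, w (Suc k))] (w (Suc k))"
    by (auto simp: awalk_simps parcs_graph pverts_graph)
  with Suc show ?case by (auto simp: spine_walk_def intro: awalk_appendI)
qed

lemma awalk_item_walk: "i < n \<Longrightarrow> awalk (w 0) (item_walk i) (q i)"
  unfolding item_walk_def
  by (rule awalk_appendI[OF awalk_spine_walk]) (auto simp: awalk_simps parcs_graph pverts_graph)

lemma verts_spine_walk: "k < n \<Longrightarrow> pawalk_verts (w 0) (spine_walk k) = map w [0..<Suc k]"
  using awalk_verts_conv[of "w 0" "spine_walk k"]
  by (cases k) (auto simp: spine_walk_def)

lemma verts_item_walk:
  "i < n \<Longrightarrow> set (pawalk_verts (w 0) (item_walk i)) = insert (q i) (w ` {..min (Suc i) (n - 1)})"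
  using awalk_verts_conv[of "w 0" "item_walk i"]
  by (simp add: item_walk_def spine_walk_def comp_def ivl_disj_un(1)
      atLeast0LessThan lessThan_Suc_atMost[symmetric] lessThan_Suc insert_commute)

sublocale rooted_arborescence graph "w 0"
proof
  show "w 0 \<in> pverts graph" using n_pos by (auto simp: pverts_graph)
next
  fix v assume "v \<in> pverts graph"
  then obtain p where p: "awalk (w 0) p v"
    using awalk_spine_walk awalk_item_walk by (auto simp: pverts_graph)
  have "p' = p" if "awalk (w 0) p' v" for p'
  proof (rule unique_root_walkI[OF _ _ that p])
    show "u = u'" if "(u, v) \<in> parcs graph" "(u', v) \<in> parcs graph" for u u' v
      using that n_pos by (auto simp: parcs_graph layout_simps)
    show "(u, w 0) \<notin> parcs graph" for u
      using n_pos by (auto simp: parcs_graph layout_simps)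
  qed
  with p show "\<exists>!p. awalk (w 0) p v" by blast
qed

lemma children_spine:
  assumes "j < n"
  shows "{z. (w j, z) \<in> parcs graph} = insert (next_vert j) (if j = 0 then {} else {q (j - 1)})"
  using assms by (auto simp: graph_def layout_simps gr0_conv_Suc)

lemma children_item:
  assumes "j < n"
  shows "{z. (q j, z) \<in> parcs graph} = {}"
  using assms n_pos by (auto simp: parcs_graph layout_simps)

lemma out_degree_spine:
  assumes "j < n"
  shows "out_degree (with_proj graph) (w j) = (if j = 0 then 1 else 2)"
proof -
  have "next_vert j \<noteq> q (j - 1)" if "j > 0"
    using assms that by (auto simp: next_vert_def layout_simps)
  then show ?thesis
    unfolding out_degree_with_proj children_spine[OF assms] by (cases "j = 0") simp_all
qed

lemma out_degree_item: "j < n \<Longrightarrow> out_degree (with_proj graph) (q j) = 0"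
  by (simp add: out_degree_with_proj children_item)

lemma verts_of_out_degree_1: "verts_of_out_degree graph 1 = {w 0}"
proof -
  have "v = w 0" if "v \<in> pverts graph" "out_degree (with_proj graph) v = 1" for v
    using that(1) unfolding pverts_graph
  proof
    assume "v \<in> w ` {..<n}"
    then obtain j where j: "j < n" "v = w j" by auto
    then show ?thesis using that(2) out_degree_spine[OF j(1)] by (cases "j = 0") simp_all
  next
    assume "v \<in> q ` {..<n}"
    then show ?thesis using that(2) out_degree_item by auto
  qed
  moreover have "out_degree (with_proj graph) (w 0) = 1"
    using out_degree_spine[OF n_pos] by simp
  ultimately show ?thesis
    using root_in_verts unfolding verts_of_out_degree_def by blast
qed

lemma verts_of_out_degree_2: "verts_of_out_degree graph 2 = w ` {0<..<n}"
proof (intro set_eqI iffI)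
  fix v assume v: "v \<in> verts_of_out_degree graph 2"
  then have "v \<in> w ` {..<n} \<union> q ` {..<n}" and deg: "out_degree (with_proj graph) v = 2"
    by (simp_all add: verts_of_out_degree_def pverts_graph)
  from this(1) show "v \<in> w ` {0<..<n}"
  proof
    assume "v \<in> w ` {..<n}"
    then obtain j where j: "j < n" "v = w j" by auto
    then show ?thesis using deg out_degree_spine[OF j(1)] by (cases "j = 0") simp_all
  next
    assume "v \<in> q ` {..<n}"
    then show ?thesis using deg out_degree_item by auto
  qed
next
  fix v assume "v \<in> w ` {0<..<n}"
  then obtain j where j: "0 < j" "j < n" "v = w j" by auto
  then show "v \<in> verts_of_out_degree graph 2"
    using out_degree_spine[OF j(2)] by (simp add: verts_of_out_degree_def pverts_graph)
qed

lemma spine_is_path: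
  "is_path_graph (with_proj graph \<restriction> ({w 0} \<union> verts_of_out_degree graph 2))"
proof -
  let ?V = "w ` {..<n}"
  have V: "{w 0} \<union> verts_of_out_degree graph 2 = ?V"
  proof -
    have "{..<n} = insert 0 {0<..<n}" using n_pos by auto
    then show ?thesis by (simp add: verts_of_out_degree_2)
  qed
  let ?H = "with_proj graph \<restriction> ?V"
  let ?p = "spine_walk (n - 1)"
  have walk: "awalk (w 0) ?p (w (n - 1))" using n_pos by (simp add: awalk_spine_walk)
  have verts: "pawalk_verts (w 0) ?p = map w [0..<n]"
    using n_pos verts_spine_walk[of "n - 1"] by simp
  have arcs: "arcs ?H = set ?p"
  proof (intro set_eqI iffI)
    fix e assume "e \<in> arcs ?H"
    then obtain j where "Suc j < n" "e = (w j, w (Suc j))"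
      by (cases e) (auto simp: parcs_graph layout_simps)
    then show "e \<in> set ?p" by (auto simp: spine_walk_def)
  next
    fix e assume "e \<in> set ?p"
    then obtain j where "j < n - 1" "e = (w j, w (Suc j))"
      by (auto simp: spine_walk_def)
    moreover from this(1) have "Suc j < n" by simp
    ultimately show "e \<in> arcs ?H" by (auto simp: parcs_graph)
  qed
  have H_verts: "pre_digraph.awalk_verts ?H (w 0) ?p = map w [0..<n]"
    using verts by (simp add: awalk_verts_induce)
  \<comment> \<open>Chaining of arcs depends only on their end points, which restriction to the
    spine leaves unchanged.\<close>
  have cas: "pre_digraph.cas ?H = pcas"
  proof (intro ext)
    fix u es v show "pre_digraph.cas ?H u es v = pcas u es v"
      by (induction es arbitrary: u) (auto simp: pre_digraph.cas.simps)
  qed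
  have "pre_digraph.apath ?H (w 0) ?p (w (n - 1))"
    unfolding pre_digraph.apath_def pre_digraph.awalk_def H_verts cas arcs
    using walk n_pos inj_w by (auto simp: awalk_def distinct_map atLeast0LessThan)
  then show ?thesis
    unfolding V is_path_graph_def using H_verts arcs by (intro exI conjI) auto
qed

lemma caterpillar_graph: "caterpillar (q ` {..<n}) (w 0) graph"
proof -
  have "out_degree (with_proj graph) v = 2" if "v \<in> pverts graph - insert (w 0) (q ` {..<n})" for v
    using that out_degree_spine by (auto simp: pverts_graph split: if_splits)
  moreover have "rooted_arborescence graph (w 0)" by unfold_locales
  ultimately show ?thesis
    using spine_is_path verts_of_out_degree_1 out_degree_spine[OF n_pos] out_degree_item
    by (auto simp: caterpillar_def proper_arborescence_def arborescence_iff_rooted)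
qed

text \<open>One child of \<open>w j\<close> is the leaf \<open>q (j - 1)\<close>, below which there
  is at most one item.\<close>

lemma branch_cost_le:
  assumes "0 < j" "j < n"
  shows "branch_cost graph P (w j) \<le> 1"
proof -
  let ?A = "{items_below graph P x | x. (w j, x) \<in> parcs graph}"
  have q: "q (j - 1) \<in> {x. (w j, x) \<in> parcs graph}"
    using assms by (simp add: children_spine)
  have "?A = items_below graph P ` {x. (w j, x) \<in> parcs graph}" by auto
  also have "finite \<dots>" using assms by (simp add: children_spine)
  finally have "branch_cost graph P (w j) \<le> items_below graph P (q (j - 1))"
    unfolding branch_cost_def using q by (intro Min_le) auto
  also have "sub_verts graph (q (j - 1)) = {q (j - 1)}"
    using assms children_item[of "j - 1"] by (subst sub_verts_eq) (auto simp: pverts_graph)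
  then have "items_below graph P (q (j - 1)) \<le> 1"
    by (simp add: items_below_def Int_insert_right)
  finally show ?thesis .
qed

text \<open>All spine vertices lie at \<open>m\<close>, so only the last arc can have positive
  length. The only item on the walk is its end, and each of the at most
  \<open>min (Suc i) (n - 1)\<close> branchings costs at most 1.\<close>

lemma delay_to_item_le:
  assumes i: "i < n" and P: "P = q ` {..<n}"
    and \<nu>: "\<And>j. j < n \<Longrightarrow> \<nu> (w j) = m" and "c m m = 0"
  shows "delay_to c P (w 0) \<delta> graph \<nu> (q i) \<le> c m (\<nu> (q i)) + \<delta> + real (min (Suc i) (n - 1))"
proof -
  let ?k = "min (Suc i) (n - 1)"
  let ?V = "set (pawalk_verts (w 0) (item_walk i))"
  have "(\<Sum>(u, v)\<leftarrow>spine_walk k. c (\<nu> u) (\<nu> v)) = 0" if "k < n" for k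
    using that by (induction k) (auto simp: spine_walk_def \<nu> \<open>c m m = 0\<close>)
  then have travel: "(\<Sum>(u, v)\<leftarrow>item_walk i. c (\<nu> u) (\<nu> v)) = c m (\<nu> (q i))"
    using n_pos by (simp add: item_walk_def \<nu>)
  have V: "?V = insert (q i) (w ` {..?k})" by (rule verts_item_walk[OF i])
  have "P \<inter> ?V = {q i}"
    unfolding V P using i n_pos by (auto simp: layout_simps)
  then have items: "card (P \<inter> ?V) = 1" by simp
  \<comment> \<open>The index 0 drops out because the root has out-degree 1; without this the count
    would be one too large.\<close>
  have V2: "?V \<inter> verts_of_out_degree graph 2 \<subseteq> w ` {0<..?k}"
    unfolding V verts_of_out_degree_2 using i n_pos by (auto simp: layout_simps)
  have "(\<Sum>v\<in>?V \<inter> verts_of_out_degree graph 2. branch_cost graph P v) \<le>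
      (\<Sum>v\<in>?V \<inter> verts_of_out_degree graph 2. 1)"
    using branch_cost_le by (intro sum_mono) (auto simp: verts_of_out_degree_2)
  also have "\<dots> \<le> card (w ` {0<..?k})"
    using V2 by (simp add: card_mono)
  also have "\<dots> \<le> ?k"
    using card_image_le[of "{0<..?k}" w] by simp
  finally show ?thesis
    unfolding delay_to_eq[OF awalk_item_walk[OF i]] travel items of_nat_1 mult_1_right
    by (intro add_left_mono of_nat_mono)
qed

end

section \<open>Optimality of the caterpillar\<close>

theorem theorem4:
  fixes M :: "'m set" and c :: "'m \<Rightarrow> 'm \<Rightarrow> real"
    and P :: "'v::infinite set" and r :: 'v and \<mu> :: "'v \<Rightarrow> 'm"
    and \<delta> \<sigma> \<Delta> :: real
  assumes "vrp_subtours_instance M c P r \<mu> \<delta> \<sigma> \<Delta>"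
  shows "\<exists>G \<mu>'. schedule M P r \<mu> G \<mu>' \<and>
           (\<forall>H \<nu>. schedule M P r \<mu> H \<nu> \<longrightarrow> delay c P r \<delta> G \<mu>' \<le> delay c P r \<delta> H \<nu>) \<and>
           caterpillar P r G \<and>
           (\<forall>w \<in> verts_of_out_degree G 2. \<mu>' w = \<mu>' r)"
proof -
  interpret vrp_subtours_instance M c P r \<mu> \<delta> \<sigma> \<Delta> by fact
  obtain xs where xs: "set xs = P" "distinct xs"
    using finite_distinct_list[OF finite_items] by blast
  \<comment> \<open>Sorting is increasing, so the negated distance puts the farthest items
    first.\<close>
  define ps where "ps = sort_key (\<lambda>p. - c (\<mu> r) (\<mu> p)) xs"
  define n where "n = card P"
  define q where "q = (!) ps"
  have ps: "set ps = P" "distinct ps" "length ps = n" "sorted (map (\<lambda>p. - c (\<mu> r) (\<mu> p)) ps)"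
    using xs by (auto simp: ps_def n_def distinct_card[symmetric])
  have far: "c (\<mu> r) (\<mu> (q i)) \<le> c (\<mu> r) (\<mu> (q j))" if "j \<le> i" "i < n" for i j
    using sorted_nth_mono[OF ps(4), of j i] that ps(3) by (simp add: q_def)
  have qP: "q ` {..<n} = P"
    using ps by (auto simp: q_def set_conv_nth)
  have inj_q: "inj_on q {..<n}"
    using ps by (auto simp: q_def inj_on_def nth_eq_iff_index_eq)
  have "infinite (- insert r P)"
    using finite_items by (simp add: Compl_eq_Diff_UNIV infinite_UNIV)
  then obtain f :: "nat \<Rightarrow> 'v" where f: "inj f" "range f \<subseteq> - insert r P"
    using infinite_countable_subset by blast
  define w where "w = case_nat r f"
  have w0: "w 0 = r" by (simp add: w_def)
  have fresh: "f j \<noteq> r" "f j \<notin> P" for j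
    using f(2) by auto
  have "inj w"
    using f(1) fresh(1) by (auto simp: w_def inj_def split: nat.splits)
  have wP: "w j \<notin> P" for j
    using fresh(2) root_no_item by (auto simp: w_def split: nat.splits)
  interpret caterpillar_layout n w q
    using finite_items items_nonempty inj_q \<open>inj w\<close> wP qP
    by unfold_locales (auto simp: n_def card_gt_0_iff intro: inj_on_subset)
  \<comment> \<open>Every vertex other than an item is placed at the root's location, which makes
    travel along the spine free.\<close>
  define \<nu> where "\<nu> v = (if v \<in> P then \<mu> v else \<mu> r)" for v
  have cat: "caterpillar P r graph"
    using caterpillar_graph by (simp add: qP w0)
  have sched: "schedule M P r \<mu> graph \<nu>"
    unfolding schedule_def
  proof (intro conjI ballI)
    show "arborescence graph r" using cat by (simp add: caterpillar_def proper_arborescence_def)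
    show "P \<subseteq> pverts graph" by (simp add: pverts_graph qP)
    show "out_degree (with_proj graph) v \<le> 2" if "v \<in> pverts graph" for v
      using that by (auto simp: pverts_graph out_degree_spine out_degree_item)
    show "out_degree (with_proj graph) p \<le> 1" if "p \<in> P" for p
      using that out_degree_item by (auto simp: qP[symmetric])
  qed (use root_no_item locations in \<open>auto simp: \<nu>_def\<close>)
  have "delay c P r \<delta> graph \<nu> \<le> delay c P r \<delta> H \<nu>'" if H: "schedule M P r \<mu> H \<nu>'" for H \<nu>'
    \<comment> \<open>Only the left maximum is unfolded: the delay of each single item of the
      caterpillar is compared with the whole delay of \<open>H\<close>.\<close>
    unfolding delay_def[of _ _ _ _ graph]
  proof (intro Max.boundedI)
    fix b assume "b \<in> delay_to c P r \<delta> graph \<nu> ` P"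
    then obtain i where i: "i < n" and b: "b = delay_to c P r \<delta> graph \<nu> (q i)"
      by (auto simp: qP[symmetric])
    have le: "b \<le> c (\<mu> r) (\<mu> (q i)) + \<delta> + real (min (Suc i) (n - 1))"
      using delay_to_item_le[OF i qP[symmetric], of \<nu> "\<mu> r" c \<delta>] locations i qP
      by (auto simp: b w0 \<nu>_def wP)
    \<comment> \<open>The target set consists of the items up to and including \<open>q i\<close>,
      none of which is nearer to the root than \<open>q i\<close>. Indices start at 0, so it has
      \<open>Suc i\<close> elements, and the lower bound matches the upper bound for
      \<open>q i\<close> exactly.\<close>
    have "q ` {..i} \<subseteq> P"
      unfolding qP[symmetric] using i by (intro image_mono) auto
    moreover have "c (\<mu> r) (\<mu> (q i)) \<le> c (\<mu> r) (\<mu> s)" if "s \<in> q ` {..i}" for s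
      using that far i by auto
    moreover have "card (q ` {..i}) = Suc i"
      using i inj_q by (subst card_image) (auto intro: inj_on_subset)
    ultimately have "c (\<mu> r) (\<mu> (q i)) + \<delta> + real (min (Suc i) (n - 1)) \<le> delay c P r \<delta> H \<nu>'"
      using schedule_delay_ge[OF H finite_items delta_ge_1, of "q ` {..i}" "c (\<mu> r) (\<mu> (q i))"]
      by (simp add: n_def)
    with le show "b \<le> delay c P r \<delta> H \<nu>'" by (rule order_trans)
  qed (use finite_items items_nonempty in auto)
  moreover have "\<forall>v \<in> verts_of_out_degree graph 2. \<nu> v = \<nu> r"
    using root_no_item by (auto simp: verts_of_out_degree_2 \<nu>_def wP)
  ultimately show ?thesis using sched cat by blast
qed

end
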